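(* Let $\mathcal{H}$ be a separable Hilbert space with inner product $\langle\cdot,\cdot\rangle$ and norm $\|\cdot\|$, let $\mathcal{A}$ be a self-adjoint operator on $\mathcal{H}$, and let $\mathcal{B}$ be a self-adjoint, strictly positive operator on $\mathcal{H}$ with bounded inverse. Let $\mathcal{H}_{\mathcal{B}}$ and $\mathcal{L}$ be as in the context, under the standing assumptions stated there. Suppose that at least one of the following holds: (C1) there exist constants $a,b>0$ such that $\|\mathcal{B}^{-1/2}\mathcal{A}f\|\leq a\|f\|+b\|\mathcal{B}^{1/2}f\|$ for all $f\in\mathcal{D}(\mathcal{A})\cap\mathcal{D}(\mathcal{B}^{1/2})$; (C2) $\mathcal{D}(\mathcal{B})\subset\mathcal{D}(\mathcal{A})$ and there exist constants $a,b>0$ such that $\|\mathcal{A}f\|\leq a\|f\|+b\|\mathcal{B}f\|$ for all $f\in\mathcal{D}(\mathcal{B})$; (C3) the spectrum of $\mathcal{A}$ is not all of $\mathbb{R}$, $\mathcal{D}(\mathcal{A})\subset\mathcal{D}(\mathcal{B})$, and there exist constants $a,b>0$ such that $\|\mathcal{B}f\|\leq a\|f\|+b\|\mathcal{A}f\|$ for all $f\in\mathcal{D}(\mathcal{A})$. Then $\mathcal{L}$ is self-adjoint on $\mathcal{H}_{\mathcal{B}}$. Moreover, if (C1) holds, then $\mathcal{L}$ is bounded on $\mathcal{H}_{\mathcal{B}}$.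
   Context: $\mathcal{H}_{\mathcal{B}}$ denotes $\mathcal{D}(\mathcal{B}^{1/2})$ equipped with the inner product $\langle f,g\rangle_{\mathcal{B}}=\langle \mathcal{B}^{1/2}f,\mathcal{B}^{1/2}g\rangle$ and norm $\|f\|_{\mathcal{B}}=\|\mathcal{B}^{1/2}f\|$; it is a Hilbert space. $\mathcal{H}_{\mathcal{B}^{-1}}$ denotes the completion of $\mathcal{H}$ with respect to the inner product $\langle f,g\rangle_{\mathcal{B}^{-1}}=\langle \mathcal{B}^{-1/2}f,\mathcal{B}^{-1/2}g\rangle$. Standing assumptions: (i) $\mathcal{D}(\mathcal{A})\cap\mathcal{D}(\mathcal{B}^{1/2})$ is dense in $\mathcal{H}_{\mathcal{B}}$; (ii) the operator $\mathcal{A}$ restricted to $\mathcal{D}(\mathcal{A})\cap\mathcal{D}(\mathcal{B}^{1/2})$, viewed as an operator from $\mathcal{H}_{\mathcal{B}}$ to $\mathcal{H}_{\mathcal{B}^{-1}}$, is closable. The operator $\mathcal{B}^{-1}\mathcal{A}$ with domain $\mathcal{D}(\mathcal{A})\cap\mathcal{D}(\mathcal{B}^{1/2})$ is symmetric in $\mathcal{H}_{\mathcal{B}}$, hence closable, and $\mathcal{L}$ denotes its closure in $\mathcal{H}_{\mathcal{B}}$: $\mathcal{L}=\overline{\mathcal{B}^{-1}\mathcal{A}|_{\mathcal{D}(\mathcal{A})\cap\mathcal{D}(\mathcal{B}^{1/2})}}$. *)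

theory Defs
  imports "HOL-Analysis.Analysis"
begin

class chilbert_space = banach +
  fixes scaleC :: "complex \<Rightarrow> 'a \<Rightarrow> 'a" (infixr \<open>*\<^sub>C\<close> 75)
  fixes cinner :: "'a \<Rightarrow> 'a \<Rightarrow> complex"
  assumes scaleC_of_real: "scaleC (complex_of_real r) x = scaleR r x"
    and scaleC_add_right: "scaleC c (x + y) = scaleC c x + scaleC c y"
    and scaleC_add_left: "scaleC (c + d) x = scaleC c x + scaleC d x"
    and scaleC_scaleC: "scaleC c (scaleC d x) = scaleC (c * d) x"
    and cinner_commute: "cinner x y = cnj (cinner y x)"
    and cinner_add_left: "cinner (x + y) z = cinner x z + cinner y z"
    and cinner_scaleC_left: "cinner (scaleC c x) y = cnj c * cinner x y"
    and cinner_self_norm: "cinner x x = complex_of_real ((norm x)\<^sup>2)"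

definition separable_space :: "'a::topological_space itself \<Rightarrow> bool" where
  "separable_space _ \<longleftrightarrow> (\<exists>C::'a set. countable C \<and> closure C = UNIV)"

text \<open>An (unbounded) operator is represented by its domain D and a function T
(whose values outside D are irrelevant).\<close>

text \<open>Self-adjointness of (D,T) in a pre-Hilbert space given by a subspace V of the
ambient type with inner product ip: D is dense in V (w.r.t. the norm induced by ip),
T is symmetric, and the domain of the adjoint is contained in D (so T* = T).\<close>
definition self_adjoint_in ::
  "'a::chilbert_space set \<Rightarrow> ('a \<Rightarrow> 'a \<Rightarrow> complex) \<Rightarrow> 'a set \<Rightarrow> ('a \<Rightarrow> 'a) \<Rightarrow> bool" where
  "self_adjoint_in V ip D T \<longleftrightarrow>
     D \<subseteq> V \<and> T ` D \<subseteq> V \<and>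
     (\<forall>g\<in>V. \<forall>e>0. \<exists>f\<in>D. sqrt (Re (ip (g - f) (g - f))) < e) \<and>
     (\<forall>f\<in>D. \<forall>g\<in>D. ip (T f) g = ip f (T g)) \<and>
     (\<forall>g\<in>V. (\<exists>h\<in>V. \<forall>f\<in>D. ip (T f) g = ip f h) \<longrightarrow> g \<in> D)"

definition self_adjoint_op :: "'a::chilbert_space set \<Rightarrow> ('a \<Rightarrow> 'a) \<Rightarrow> bool" where
  "self_adjoint_op D T \<longleftrightarrow> self_adjoint_in UNIV cinner D T"

definition positive_op :: "'a::chilbert_space set \<Rightarrow> ('a \<Rightarrow> 'a) \<Rightarrow> bool" where
  "positive_op D T \<longleftrightarrow> (\<forall>f\<in>D. 0 \<le> Re (cinner (T f) f))"

definition strictly_positive_op :: "'a::chilbert_space set \<Rightarrow> ('a \<Rightarrow> 'a) \<Rightarrow> bool" where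
  "strictly_positive_op D T \<longleftrightarrow> (\<forall>f\<in>D. f \<noteq> 0 \<longrightarrow> 0 < Re (cinner (T f) f))"

definition has_bounded_inverse :: "'a::chilbert_space set \<Rightarrow> ('a \<Rightarrow> 'a) \<Rightarrow> bool" where
  "has_bounded_inverse D T \<longleftrightarrow>
     (\<forall>g. \<exists>f\<in>D. T f = g) \<and> (\<exists>C. \<forall>f\<in>D. norm f \<le> C * norm (T f))"

definition spectrum_op :: "'a::chilbert_space set \<Rightarrow> ('a \<Rightarrow> 'a) \<Rightarrow> complex set" where
  "spectrum_op D T = {z. \<not> ((\<forall>g. \<exists>f\<in>D. T f - z *\<^sub>C f = g) \<and>
                           (\<exists>C. \<forall>f\<in>D. norm f \<le> C * norm (T f - z *\<^sub>C f)))}"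

text \<open>Square root of a positive self-adjoint operator: the unique positive self-adjoint
operator S with S S = T (as operators, including domains). Values of S outside its
domain are normalised to 0 to make it unique.\<close>
definition op_sqrt_pair :: "'a::chilbert_space set \<Rightarrow> ('a \<Rightarrow> 'a) \<Rightarrow> 'a set \<times> ('a \<Rightarrow> 'a)" where
  "op_sqrt_pair D T = (THE p. case p of (DS, S) \<Rightarrow>
      self_adjoint_op DS S \<and> positive_op DS S \<and> (\<forall>f. f \<notin> DS \<longrightarrow> S f = 0) \<and>
      D = {f \<in> DS. S f \<in> DS} \<and> (\<forall>f\<in>D. S (S f) = T f))"

definition op_sqrt_dom :: "'a::chilbert_space set \<Rightarrow> ('a \<Rightarrow> 'a) \<Rightarrow> 'a set" where
  "op_sqrt_dom D T = fst (op_sqrt_pair D T)"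

definition op_sqrt :: "'a::chilbert_space set \<Rightarrow> ('a \<Rightarrow> 'a) \<Rightarrow> 'a \<Rightarrow> 'a" where
  "op_sqrt D T = snd (op_sqrt_pair D T)"

definition closure_graph ::
  "'a::chilbert_space set \<Rightarrow> ('a \<Rightarrow> real) \<Rightarrow> 'a set \<Rightarrow> ('a \<Rightarrow> 'a) \<Rightarrow> 'a \<Rightarrow> 'a \<Rightarrow> bool" where
  "closure_graph V nrm D0 T f g \<longleftrightarrow> f \<in> V \<and> g \<in> V \<and>
     (\<exists>u. (\<forall>n. u n \<in> D0) \<and> (\<lambda>n. nrm (u n - f)) \<longlonglongrightarrow> 0 \<and> (\<lambda>n. nrm (T (u n) - g)) \<longlonglongrightarrow> 0)"

definition op_closure_dom ::
  "'a::chilbert_space set \<Rightarrow> ('a \<Rightarrow> real) \<Rightarrow> 'a set \<Rightarrow> ('a \<Rightarrow> 'a) \<Rightarrow> 'a set" where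
  "op_closure_dom V nrm D0 T = {f. \<exists>g. closure_graph V nrm D0 T f g}"

definition op_closure ::
  "'a::chilbert_space set \<Rightarrow> ('a \<Rightarrow> real) \<Rightarrow> 'a set \<Rightarrow> ('a \<Rightarrow> 'a) \<Rightarrow> 'a \<Rightarrow> 'a" where
  "op_closure V nrm D0 T f = (THE g. closure_graph V nrm D0 T f g)"

end

theory Submission
  imports Defs
begin

text \<open>Put \<open>R = B\<^bsup>-1/2\<^esup>\<close>, a bounded operator, and \<open>S = B\<^bsup>1/2\<^esup>\<close>. Since \<open>S\<close> is an isometry from the energy space
onto the Hilbert space, the claim is that \<open>R A R\<close> is essentially self-adjoint. Under (C1) it is
bounded on a dense domain. Under (C2) the operator \<open>T = A B\<^bsup>-1\<^esup>\<close> is bounded and symmetric for the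
weaker inner product \<open>\<langle>R x, R y\<rangle>\<close>, hence bounded for its norm by a theorem of Krein and Lax, which
means that \<open>R A R\<close> is bounded on the range of \<open>R\<close>. Under (C3) the same theorem applied to
\<open>T = B (A - r)\<^bsup>-1\<^esup>\<close>, for a real \<open>r\<close> outside the spectrum, shows that \<open>S (A - r)\<^bsup>-1\<^esup> S\<close> is bounded, and
its closure is the inverse of the closure of \<open>R (A - r) R\<close>; the difference \<open>r R\<^sup>2\<close> is bounded.\<close>

subsection \<open>The inner product\<close>

lemma cinner_add_right: "cinner x (y + z) = cinner x y + cinner x (z :: 'a::chilbert_space)"
  by (metis cinner_add_left cinner_commute complex_cnj_add)

lemma cinner_scaleR_left: "cinner (r *\<^sub>R x) y = r *\<^sub>R cinner x (y :: 'a::chilbert_space)"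
  by (metis cinner_scaleC_left complex_cnj_complex_of_real scaleC_of_real scaleR_conv_of_real)

lemma cinner_scaleR_right: "cinner x (r *\<^sub>R y) = r *\<^sub>R cinner x (y :: 'a::chilbert_space)"
  by (metis cinner_commute cinner_scaleR_left complex_cnj_scaleR)

lemma Re_cinner_commute: "Re (cinner x y) = Re (cinner y (x :: 'a::chilbert_space))"
  by (subst cinner_commute) simp

lemma Re_cinner_self: "Re (cinner x x) = (norm (x :: 'a::chilbert_space))\<^sup>2"
  by (simp add: cinner_self_norm)

text \<open>The form may be degenerate. If \<open>q y y > 0\<close>, the quadratic in
  \<open>t\<close> is evaluated at its minimum; if \<open>q y y = 0\<close>, a function linear in
  \<open>t\<close> stays nonnegative, which forces \<open>q x y = 0\<close>. It serves both the
  inner product and the form of a positive operator.\<close>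

lemma psd_Cauchy_Schwarz:
  fixes q :: "'a::real_vector \<Rightarrow> 'a \<Rightarrow> real"
  assumes add: "\<And>x y z. q (x + y) z = q x z + q y z"
    and scale: "\<And>r x y. q (r *\<^sub>R x) y = r * q x y"
    and sym: "\<And>x y. q x y = q y x" and nonneg: "\<And>x. 0 \<le> q x x"
  shows "(q x y)\<^sup>2 \<le> q x x * q y y"
proof -
  have quad: "0 \<le> q x x + 2 * t * q x y + t\<^sup>2 * q y y" for t
  proof -
    have add': "q x (y + z) = q x y + q x z" and scale': "q x (r *\<^sub>R y) = r * q x y" for x y z r
      using add scale sym by metis+
    have "q (x + t *\<^sub>R y) (x + t *\<^sub>R y) = q x x + 2 * t * q x y + t\<^sup>2 * q y y"
      by (simp add: add scale add' scale' sym[of y x] power2_eq_square algebra_simps)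
    then show ?thesis using nonneg[of "x + t *\<^sub>R y"] by simp
  qed
  show ?thesis
  proof (cases "q y y = 0")
    case True
    have "q x y = 0"
    proof (rule ccontr)
      assume "q x y \<noteq> 0"
      then show False
        using quad[of "- (q x x + 1) / (2 * q x y)"] True by (simp add: field_simps)
    qed
    then show ?thesis using True by simp
  next
    case False
    then have pos: "0 < q y y" using nonneg[of y] by simp
    have "0 \<le> q y y * (q x x + 2 * (- q x y / q y y) * q x y + (- q x y / q y y)\<^sup>2 * q y y)"
      using quad[of "- q x y / q y y"] pos by simp
    also have "\<dots> = q x x * q y y - (q x y)\<^sup>2"
      using pos by (simp add: field_simps power2_eq_square)
    finally show ?thesis by simp
  qed
qed

lemma Re_cinner_le: "Re (cinner x y) \<le> norm x * norm (y :: 'a::chilbert_space)"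
proof -
  have "(Re (cinner x y))\<^sup>2 \<le> Re (cinner x x) * Re (cinner y y)"
    by (rule psd_Cauchy_Schwarz[of "\<lambda>x y. Re (cinner x y)"])
      (auto simp: cinner_add_left cinner_scaleR_left Re_cinner_commute Re_cinner_self)
  then have "(Re (cinner x y))\<^sup>2 \<le> (norm x * norm y)\<^sup>2"
    by (simp add: Re_cinner_self power_mult_distrib)
  then show ?thesis
    by (meson mult_nonneg_nonneg norm_ge_zero power2_le_imp_le)
qed

lemma norm_scaleC: "norm (c *\<^sub>C x) = norm c * norm (x :: 'a::chilbert_space)"
proof -
  have "cinner (c *\<^sub>C x) (c *\<^sub>C x) = cnj c * (c * complex_of_real ((norm x)\<^sup>2))"
    by (metis cinner_commute cinner_scaleC_left cinner_self_norm complex_cnj_cnj complex_cnj_mult)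
  also have "\<dots> = c * cnj c * complex_of_real ((norm x)\<^sup>2)" by (simp add: ac_simps)
  also have "\<dots> = complex_of_real ((norm c * norm x)\<^sup>2)"
    by (simp only: complex_norm_square[symmetric] power_mult_distrib of_real_mult)
  finally have "complex_of_real ((norm (c *\<^sub>C x))\<^sup>2) = complex_of_real ((norm c * norm x)\<^sup>2)"
    by (simp only: cinner_self_norm)
  then show ?thesis
    by (metis mult_nonneg_nonneg norm_ge_zero of_real_eq_iff power2_eq_imp_eq)
qed

text \<open>Multiplying \<open>x\<close> by \<open>c = cinner x y\<close> turns the inner product
  into the real number \<open>cnj c * c\<close>, so the bound for real parts applies.\<close>

lemma norm_cinner_le: "norm (cinner x y) \<le> norm x * norm (y :: 'a::chilbert_space)"
proof (cases "cinner x y = 0")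
  case False
  define c where "c = cinner x y"
  have "(norm c)\<^sup>2 = Re (cinner (c *\<^sub>C x) y)"
    by (simp add: cinner_scaleC_left c_def[symmetric] mult.commute[of "cnj c"]
        complex_mult_cnj cmod_power2)
  also have "\<dots> \<le> norm c * (norm x * norm y)"
    using Re_cinner_le[of "c *\<^sub>C x" y] by (simp add: norm_scaleC)
  finally show ?thesis
    using False by (simp add: c_def power2_eq_square)
qed simp

lemma bounded_bilinear_cinner: "bounded_bilinear (cinner :: 'a::chilbert_space \<Rightarrow> 'a \<Rightarrow> complex)"
  by (unfold_locales; (rule exI[of _ 1])?)
    (auto simp: cinner_add_left cinner_add_right cinner_scaleR_left cinner_scaleR_right norm_cinner_le)

interpretation cinner: bounded_bilinear "cinner :: 'a::chilbert_space \<Rightarrow> 'a \<Rightarrow> complex"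
  by (rule bounded_bilinear_cinner)

lemma norm_eq_sqrt_cinner: "sqrt (Re (cinner x x)) = norm (x :: 'a::chilbert_space)"
  by (simp add: Re_cinner_self)

text \<open>Approximating \<open>d\<close> itself by some \<open>f\<close> in \<open>X\<close>
  closer than \<open>norm d\<close> contradicts \<open>cinner f d = 0\<close>.\<close>

lemma orthogonal_to_dense:
  fixes d :: "'a::chilbert_space"
  assumes dense: "\<And>g e. e > 0 \<Longrightarrow> \<exists>f\<in>X. norm (g - f) < e"
    and orth: "\<And>f. f \<in> X \<Longrightarrow> cinner f d = 0"
  shows "d = 0"
proof (rule ccontr)
  assume "d \<noteq> 0"
  then obtain f where f: "f \<in> X" "norm (d - f) < norm d" using dense[of "norm d" d] by auto
  have "(norm d)\<^sup>2 = Re (cinner (d - f) d)"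
    by (simp add: cinner.diff_left orth f Re_cinner_self)
  also have "\<dots> \<le> norm (d - f) * norm d" by (rule Re_cinner_le)
  also have "\<dots> < norm d * norm d" using f \<open>d \<noteq> 0\<close> by simp
  finally show False by (simp add: power2_eq_square)
qed

lemma cinner_eqI:
  fixes x y :: "'a::chilbert_space"
  assumes "\<And>f. cinner f x = cinner f y"
  shows "x = y"
proof -
  have "cinner (x - y) (x - y) = 0" by (simp add: cinner.diff_right assms)
  then show ?thesis by (simp add: cinner_self_norm)
qed

text \<open>The map \<open>p\<close> allows density of an image: it is used with
  \<open>p = S\<close> and \<open>p = R\<close>.\<close>

lemma dense_sequence:
  fixes g :: "'a::real_normed_vector"
  assumes "\<And>e. e > 0 \<Longrightarrow> \<exists>f\<in>X. norm (g - p f) < e"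
  obtains u where "\<And>n. u n \<in> X" "(\<lambda>n::nat. p (u n)) \<longlonglongrightarrow> g"
proof -
  have "\<forall>n. \<exists>f\<in>X. norm (g - p f) < inverse (real (Suc n))" using assms by simp
  then obtain u where u: "\<And>n. u n \<in> X" "\<And>n. norm (g - p (u n)) < inverse (real (Suc n))"
    by metis
  have "(\<lambda>n. p (u n) - g) \<longlonglongrightarrow> 0"
    by (rule Lim_null_comparison[OF _ LIMSEQ_inverse_real_of_nat])
      (metis (no_types, lifting) always_eventually less_imp_le norm_minus_commute u(2))
  then show ?thesis using that[of u] u(1) by (simp add: LIM_zero_iff)
qed

subsection \<open>Self-adjoint operators\<close>

lemma self_adjoint_op_dense:
  assumes "self_adjoint_op D T" "e > 0"
  shows "\<exists>f\<in>D. norm (g - f) < e"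
  using assms unfolding self_adjoint_op_def self_adjoint_in_def norm_eq_sqrt_cinner by blast

lemma self_adjoint_op_sym:
  assumes "self_adjoint_op D T" "f \<in> D" "g \<in> D"
  shows "cinner (T f) g = cinner f (T g)"
  using assms unfolding self_adjoint_op_def self_adjoint_in_def by blast

text \<open>Maximality in \<open>self_adjoint_in\<close> puts \<open>g\<close> into
  \<open>D\<close>; by symmetry \<open>T g - h\<close> is then orthogonal to the dense set
  \<open>D\<close>.\<close>

lemma self_adjoint_op_adjoint:
  assumes sa: "self_adjoint_op D T" and adj: "\<And>f. f \<in> D \<Longrightarrow> cinner (T f) g = cinner f h"
  shows "g \<in> D" "T g = h"
proof -
  show g: "g \<in> D"
    using assms unfolding self_adjoint_op_def self_adjoint_in_def by blast
  have "T g - h = 0"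
    by (rule orthogonal_to_dense[of D])
      (auto simp: cinner.diff_right adj[symmetric] self_adjoint_op_sym[OF sa _ g]
        intro: self_adjoint_op_dense[OF sa])
  then show "T g = h" by simp
qed

text \<open>\<open>self_adjoint_in\<close> mentions neither a linear \<open>T\<close> nor a subspace
  \<open>D\<close>. Here and in the next lemmas linearity is recovered by exhibiting the candidate
  value as an adjoint.\<close>

lemma self_adjoint_op_diff:
  assumes sa: "self_adjoint_op D T" and "f \<in> D" "g \<in> D"
  shows "f - g \<in> D" "T (f - g) = T f - T g"
proof -
  have "cinner (T k) (f - g) = cinner k (T f - T g)" if "k \<in> D" for k
    by (simp add: cinner.diff_right self_adjoint_op_sym[OF sa that] assms)
  then show "f - g \<in> D" "T (f - g) = T f - T g"
    using self_adjoint_op_adjoint[OF sa] by blast+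
qed

lemma self_adjoint_op_add:
  assumes sa: "self_adjoint_op D T" and "f \<in> D" "g \<in> D"
  shows "f + g \<in> D" "T (f + g) = T f + T g"
proof -
  have "cinner (T k) (f + g) = cinner k (T f + T g)" if "k \<in> D" for k
    by (simp add: cinner.add_right self_adjoint_op_sym[OF sa that] assms)
  then show "f + g \<in> D" "T (f + g) = T f + T g"
    using self_adjoint_op_adjoint[OF sa] by blast+
qed

lemma self_adjoint_op_scaleR:
  assumes sa: "self_adjoint_op D T" and "f \<in> D"
  shows "r *\<^sub>R f \<in> D" "T (r *\<^sub>R f) = r *\<^sub>R T f"
proof -
  have "cinner (T k) (r *\<^sub>R f) = cinner k (r *\<^sub>R T f)" if "k \<in> D" for k
    by (simp add: cinner.scaleR_right self_adjoint_op_sym[OF sa that] assms)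
  then show "r *\<^sub>R f \<in> D" "T (r *\<^sub>R f) = r *\<^sub>R T f"
    using self_adjoint_op_adjoint[OF sa] by blast+
qed

lemma self_adjoint_op_zero:
  assumes sa: "self_adjoint_op D T"
  shows "0 \<in> D" "T 0 = 0"
  using self_adjoint_op_adjoint[OF sa, of 0 0] by (simp_all add: cinner.zero_right)

subsection \<open>The square root of a bounded positive operator\<close>

text \<open>The limit \<open>Y\<close> of the iteration satisfies \<open>2 Y = T + Y\<^sup>2\<close>, that is \<open>(1 - Y)\<^sup>2 = 1 - T\<close>. Its increments are
dominated in norm by those of the scalar iteration for \<open>T = 1\<close>, which increases to a limit.\<close>
fun sqrt_iter :: "('a::real_normed_vector \<Rightarrow>\<^sub>L 'a) \<Rightarrow> nat \<Rightarrow> ('a \<Rightarrow>\<^sub>L 'a)" where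
  "sqrt_iter T 0 = 0"
| "sqrt_iter T (Suc n) = (1/2) *\<^sub>R (T + (sqrt_iter T n o\<^sub>L sqrt_iter T n))"

fun sqrt_iter_real :: "nat \<Rightarrow> real" where
  "sqrt_iter_real 0 = 0"
| "sqrt_iter_real (Suc n) = (1 + (sqrt_iter_real n)\<^sup>2) / 2"

lemma sqrt_iter_real_bounds: "0 \<le> sqrt_iter_real n \<and> sqrt_iter_real n \<le> 1"
  by (induction n) (auto simp: power_le_one)

lemma incseq_sqrt_iter_real: "incseq sqrt_iter_real"
proof (rule incseq_SucI)
  fix n
  have "0 \<le> (1 - sqrt_iter_real n)\<^sup>2" by simp
  then show "sqrt_iter_real n \<le> sqrt_iter_real (Suc n)"
    by (simp add: power2_eq_square algebra_simps)
qed

text \<open>Each iterate is a polynomial in \<open>T\<close>. With \<open>C\<close> an iterate, this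
  makes the iterates commute with one another; with general \<open>C\<close>, it passes commutation
  on to the limit.\<close>

lemma sqrt_iter_commute:
  assumes "C o\<^sub>L T = T o\<^sub>L C"
  shows "C o\<^sub>L sqrt_iter T n = sqrt_iter T n o\<^sub>L C"
proof (induction n)
  case (Suc n)
  have "C o\<^sub>L (sqrt_iter T n o\<^sub>L sqrt_iter T n) = (sqrt_iter T n o\<^sub>L sqrt_iter T n) o\<^sub>L C"
  proof (rule blinfun_eqI)
    have "C (sqrt_iter T n z) = sqrt_iter T n (C z)" for z
      using arg_cong[OF Suc.IH, of "\<lambda>X. blinfun_apply X z"] by simp
    then show "(C o\<^sub>L (sqrt_iter T n o\<^sub>L sqrt_iter T n)) z = ((sqrt_iter T n o\<^sub>L sqrt_iter T n) o\<^sub>L C) z" for z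
      by simp
  qed
  with assms show ?case
    by (simp add: bounded_bilinear.add_left[OF bounded_bilinear_blinfun_compose]
        bounded_bilinear.add_right[OF bounded_bilinear_blinfun_compose]
        bounded_bilinear.scaleR_left[OF bounded_bilinear_blinfun_compose]
        bounded_bilinear.scaleR_right[OF bounded_bilinear_blinfun_compose])
qed (simp add: bounded_bilinear.zero_left[OF bounded_bilinear_blinfun_compose]
        bounded_bilinear.zero_right[OF bounded_bilinear_blinfun_compose])

lemma norm_sqrt_iter:
  assumes "norm T \<le> 1"
  shows "norm (sqrt_iter T n) \<le> sqrt_iter_real n"
proof (induction n)
  case (Suc n)
  have "norm (sqrt_iter T n o\<^sub>L sqrt_iter T n) \<le> norm (sqrt_iter T n) * norm (sqrt_iter T n)"
    by (rule norm_blinfun_compose)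
  also have "\<dots> \<le> (sqrt_iter_real n)\<^sup>2"
    unfolding power2_eq_square by (intro mult_mono Suc.IH) (use sqrt_iter_real_bounds in auto)
  finally show ?case
    using norm_triangle_ineq[of T "sqrt_iter T n o\<^sub>L sqrt_iter T n"] assms by simp
qed simp

text \<open>Since iterates commute, the next increment is half the sum times the difference of the
  last two. The scalar iteration factors in the same way, so the bounds multiply.\<close>

lemma norm_sqrt_iter_diff:
  assumes "norm T \<le> 1"
  shows "norm (sqrt_iter T (Suc n) - sqrt_iter T n) \<le> sqrt_iter_real (Suc n) - sqrt_iter_real n"
proof (induction n)
  case (Suc n)
  let ?a = "sqrt_iter T (Suc n)" and ?b = "sqrt_iter T n"
  let ?x = "sqrt_iter_real (Suc n)" and ?y = "sqrt_iter_real n"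
  have "?a o\<^sub>L ?b = ?b o\<^sub>L ?a"
    by (intro sqrt_iter_commute sqrt_iter_commute[symmetric] refl)
  then have "sqrt_iter T (Suc (Suc n)) - ?a = (1/2) *\<^sub>R ((?a + ?b) o\<^sub>L (?a - ?b))"
    using sqrt_iter.simps(2)[of T "Suc n"] sqrt_iter.simps(2)[of T n]
    by (simp add: bounded_bilinear.add_left[OF bounded_bilinear_blinfun_compose]
        bounded_bilinear.diff_right[OF bounded_bilinear_blinfun_compose]
        scaleR_diff_right[symmetric] del: sqrt_iter.simps)
  then have "norm (sqrt_iter T (Suc (Suc n)) - ?a) = norm ((1/2) *\<^sub>R ((?a + ?b) o\<^sub>L (?a - ?b)))"
    by simp
  also have "\<dots> \<le> (norm (?a + ?b) * norm (?a - ?b)) / 2"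
    using norm_blinfun_compose[of "?a + ?b" "?a - ?b"] by simp
  also have "\<dots> \<le> ((?x + ?y) * (?x - ?y)) / 2"
  proof (intro divide_right_mono mult_mono)
    show "norm (?a - ?b) \<le> ?x - ?y" by (rule Suc.IH)
    show "norm (?a + ?b) \<le> ?x + ?y"
      using norm_triangle_mono[OF norm_sqrt_iter[OF assms] norm_sqrt_iter[OF assms]] .
    show "0 \<le> ?x + ?y" using sqrt_iter_real_bounds[of "Suc n"] sqrt_iter_real_bounds[of n] by linarith
  qed auto
  also have "\<dots> = sqrt_iter_real (Suc (Suc n)) - ?x"
  proof -
    have "sqrt_iter_real (Suc (Suc n)) = (1 + ?x\<^sup>2) / 2" and "?x = (1 + ?y\<^sup>2) / 2" by simp_all
    moreover have "(?x + ?y) * (?x - ?y) = ?x\<^sup>2 - ?y\<^sup>2"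
      by (simp only: power2_eq_square square_diff_square_factored)
    ultimately show ?thesis by argo
  qed
  finally show ?case .
qed (use assms in simp)

text \<open>Telescoping the increment bounds transfers the Cauchy property from the scalar sequence,
  which converges because it increases and is bounded by 1.\<close>

lemma convergent_sqrt_iter:
  fixes T :: "'a::banach \<Rightarrow>\<^sub>L 'a"
  assumes T: "norm T \<le> 1"
  shows "convergent (sqrt_iter T)"
proof -
  have le: "norm (sqrt_iter T (n + k) - sqrt_iter T n) \<le> sqrt_iter_real (n + k) - sqrt_iter_real n"
    for n k
  proof (induction k)
    case (Suc k)
    then show ?case
      using norm_sqrt_iter_diff[OF T, of "n + k"]
        norm_triangle_ineq[of "sqrt_iter T (n + Suc k) - sqrt_iter T (n + k)"
          "sqrt_iter T (n + k) - sqrt_iter T n"]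
      by (simp del: sqrt_iter.simps sqrt_iter_real.simps)
  qed simp
  have "convergent sqrt_iter_real"
    using incseq_convergent[OF incseq_sqrt_iter_real, of 1] sqrt_iter_real_bounds
    unfolding convergent_def by metis
  then have C: "Cauchy sqrt_iter_real" by (rule convergent_Cauchy)
  have "Cauchy (sqrt_iter T)"
  proof (rule CauchyI)
    fix e :: real assume "e > 0"
    then obtain M where M: "\<And>m n. M \<le> m \<Longrightarrow> M \<le> n \<Longrightarrow> \<bar>sqrt_iter_real m - sqrt_iter_real n\<bar> < e"
      using CauchyD[OF C] by (metis real_norm_def)
    show "\<exists>M. \<forall>m\<ge>M. \<forall>n\<ge>M. norm (sqrt_iter T m - sqrt_iter T n) < e"
    proof (intro exI[of _ M] allI impI)
      fix m n assume mn: "M \<le> m" "M \<le> n"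
      show "norm (sqrt_iter T m - sqrt_iter T n) < e"
      proof (cases "m \<le> n")
        case True
        then show ?thesis
          using le[of m "n - m"] M[OF mn(2,1)] by (simp add: norm_minus_commute)
      next
        case False
        then show ?thesis using le[of n "m - n"] M[OF mn] by simp
      qed
    qed
  qed
  then show ?thesis by (rule Cauchy_convergent)
qed

text \<open>Cauchy-Schwarz for the semidefinite form \<open>Re (cinner (K x) y)\<close> at
  \<open>y = K x\<close>, divided by \<open>(norm (K x))\<^sup>2\<close>.\<close>

lemma positive_op_norm_le:
  fixes K :: "'a::chilbert_space \<Rightarrow>\<^sub>L 'a"
  assumes sym: "\<And>x y. cinner (K x) y = cinner x (K y)" and pos: "\<And>x. 0 \<le> Re (cinner (K x) x)"
  shows "(norm (K x))\<^sup>2 \<le> norm K * Re (cinner (K x) x)"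
proof (cases "K x = 0")
  case False
  have "(Re (cinner (K x) (K x)))\<^sup>2 \<le> Re (cinner (K x) x) * Re (cinner (K (K x)) (K x))"
    by (rule psd_Cauchy_Schwarz[of "\<lambda>x y. Re (cinner (K x) y)"])
      (simp_all add: blinfun.add_right blinfun.scaleR_right cinner.add_left cinner.scaleR_left pos,
        metis Re_cinner_commute sym)
  also have "\<dots> \<le> Re (cinner (K x) x) * (norm K * (norm (K x))\<^sup>2)"
  proof (rule mult_left_mono[OF _ pos])
    have "Re (cinner (K (K x)) (K x)) \<le> norm (K (K x)) * norm (K x)" by (rule Re_cinner_le)
    also have "\<dots> \<le> (norm K * norm (K x)) * norm (K x)"
      by (intro mult_right_mono norm_blinfun) auto
    finally show "Re (cinner (K (K x)) (K x)) \<le> norm K * (norm (K x))\<^sup>2"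
      by (simp add: power2_eq_square)
  qed
  finally have "(norm (K x))\<^sup>2 * (norm (K x))\<^sup>2 \<le> (norm (K x))\<^sup>2 * (norm K * Re (cinner (K x) x))"
    by (simp add: Re_cinner_self ac_simps flip: power2_eq_square[of "(norm (K x))\<^sup>2"])
  moreover have "0 < (norm (K x))\<^sup>2" using False by simp
  ultimately show ?thesis by (rule mult_left_le_imp_le)
qed (simp add: cinner.zero_left)

lemma positive_sqrt_exists:
  fixes K :: "'a::chilbert_space \<Rightarrow>\<^sub>L 'a"
  assumes sym: "\<And>x y. cinner (K x) y = cinner x (K y)" and pos: "\<And>x. 0 \<le> Re (cinner (K x) x)"
  obtains R :: "'a \<Rightarrow>\<^sub>L 'a" where
    "R o\<^sub>L R = K" "\<And>x y. cinner (R x) y = cinner x (R y)" "\<And>x. 0 \<le> Re (cinner (R x) x)"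
    "\<And>C. C o\<^sub>L K = K o\<^sub>L C \<Longrightarrow> C o\<^sub>L R = R o\<^sub>L C"
proof -
  interpret comp: bounded_bilinear "(o\<^sub>L) :: ('a \<Rightarrow>\<^sub>L 'a) \<Rightarrow> ('a \<Rightarrow>\<^sub>L 'a) \<Rightarrow> _"
    by (rule bounded_bilinear_blinfun_compose)
  have I_left[simp]: "id_blinfun o\<^sub>L X = X" and I_right[simp]: "X o\<^sub>L id_blinfun = X" for X :: "'a \<Rightarrow>\<^sub>L 'a"
    by (auto intro: blinfun_eqI)
  \<comment> \<open>Adding 1 keeps \<open>c\<close> positive even when \<open>K = 0\<close>;
    \<open>norm K \<le> c\<close> makes \<open>T = 1 - K/c\<close> a contraction.\<close>
  define c where "c = norm K + 1"
  have c: "c > 0" "norm K \<le> c" by (auto simp: c_def add_nonneg_pos)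
  define T where "T = id_blinfun - (1/c) *\<^sub>R K"
  have Tx: "T x = x - (1/c) *\<^sub>R K x" for x by (simp add: T_def blinfun.diff_left blinfun.scaleR_left)
  have T: "norm T \<le> 1"
  proof (rule norm_blinfun_bound)
    fix x
    have "(norm (K x))\<^sup>2 \<le> c * Re (cinner (K x) x)"
      using positive_op_norm_le[OF sym pos, of x] mult_right_mono[OF c(2) pos[of x]] by linarith
    then have le: "(1/c)\<^sup>2 * (norm (K x))\<^sup>2 \<le> (1/c) * Re (cinner (K x) x)"
      using c(1) by (simp add: field_simps power2_eq_square)
    have "(norm (T x))\<^sup>2 = (norm x)\<^sup>2 - 2 * (1/c) * Re (cinner (K x) x) + (1/c)\<^sup>2 * (norm (K x))\<^sup>2"
      unfolding Re_cinner_self[symmetric] Tx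
      by (simp add: cinner.diff_left cinner.diff_right cinner.scaleR_left cinner.scaleR_right
          Re_cinner_commute[of x "K x"] power2_eq_square algebra_simps)
    also have "\<dots> \<le> (norm x)\<^sup>2"
      using le mult_nonneg_nonneg[OF _ pos[of x], of "1/c"] c(1) by simp
    finally show "norm (T x) \<le> 1 * norm x" using power2_le_imp_le[of "norm (T x)" "norm x"] by simp
  qed simp
  have T_sym: "cinner (T x) y = cinner x (T y)" for x y
    by (simp add: Tx cinner.diff_left cinner.diff_right cinner.scaleR_left cinner.scaleR_right sym)
  obtain Y where Y: "sqrt_iter T \<longlonglongrightarrow> Y"
    using convergent_sqrt_iter[OF T] by (auto simp: convergent_def)
  have Y_app: "(\<lambda>n. sqrt_iter T n x) \<longlonglongrightarrow> Y x" for x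
    using blinfun.tendsto[OF Y tendsto_const] .
  have Y_fix: "Y = (1/2) *\<^sub>R (T + (Y o\<^sub>L Y))"
  proof (rule LIMSEQ_unique)
    show "(\<lambda>n. sqrt_iter T (Suc n)) \<longlonglongrightarrow> Y" using Y by (rule LIMSEQ_Suc)
    show "(\<lambda>n. sqrt_iter T (Suc n)) \<longlonglongrightarrow> (1/2) *\<^sub>R (T + (Y o\<^sub>L Y))"
      unfolding sqrt_iter.simps by (intro tendsto_intros comp.tendsto Y)
  qed
  have Y_sym: "cinner (Y x) y = cinner x (Y y)" for x y
  proof (rule LIMSEQ_unique)
    have "cinner (sqrt_iter T n x) y = cinner x (sqrt_iter T n y)" for n
      by (induction n arbitrary: x y)
        (auto simp: cinner.zero_left cinner.zero_right blinfun.scaleR_left blinfun.add_left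
          cinner.scaleR_left cinner.scaleR_right cinner.add_left cinner.add_right T_sym)
    then show "(\<lambda>n. cinner (sqrt_iter T n x) y) \<longlonglongrightarrow> cinner x (Y y)"
      using cinner.tendsto[OF tendsto_const[of x] Y_app[of y]] by simp
    show "(\<lambda>n. cinner (sqrt_iter T n x) y) \<longlonglongrightarrow> cinner (Y x) y"
      using cinner.tendsto[OF Y_app tendsto_const] .
  qed
  have Y_norm: "norm Y \<le> 1"
    by (rule LIMSEQ_le_const2[OF tendsto_norm[OF Y]])
      (use norm_sqrt_iter[OF T] sqrt_iter_real_bounds in \<open>metis order_trans\<close>)
  have TK: "K = c *\<^sub>R (id_blinfun - T)" using c(1) by (simp add: T_def)
  \<comment> \<open>The fixed point equation gives \<open>(1 - Y)\<^sup>2 = 1 - T = K/c\<close>;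
    \<open>norm Y \<le> 1\<close> makes \<open>1 - Y\<close> positive.\<close>
  define R where "R = sqrt c *\<^sub>R (id_blinfun - Y)"
  have Rx: "R x = sqrt c *\<^sub>R (x - Y x)" for x
    by (simp add: R_def blinfun.diff_left blinfun.scaleR_left)
  show ?thesis
  proof (rule that[of R])
    have "(2::real) *\<^sub>R Y = T + (Y o\<^sub>L Y)" by (subst Y_fix) simp
    then have "(id_blinfun - Y) o\<^sub>L (id_blinfun - Y) = id_blinfun - T"
      by (simp add: comp.diff_left comp.diff_right scaleR_2 algebra_simps)
    then show "R o\<^sub>L R = K"
      using c(1) by (simp add: R_def comp.scaleR_left comp.scaleR_right TK)
    show "cinner (R x) y = cinner x (R y)" for x y
      by (simp add: Rx cinner.diff_left cinner.diff_right cinner.scaleR_left cinner.scaleR_right Y_sym)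
    show "0 \<le> Re (cinner (R x) x)" for x
    proof -
      have "Re (cinner (Y x) x) \<le> norm (Y x) * norm x" by (rule Re_cinner_le)
      also have "\<dots> \<le> (1 * norm x) * norm x"
        using norm_blinfun[of Y x] mult_right_mono[OF Y_norm norm_ge_zero[of x]]
        by (intro mult_right_mono) auto
      finally show ?thesis
        using c(1) by (simp add: Rx cinner.scaleR_left cinner.diff_left Re_cinner_self power2_eq_square)
    qed
    fix C assume "C o\<^sub>L K = K o\<^sub>L C"
    then have CT: "C o\<^sub>L T = T o\<^sub>L C"
      by (simp add: T_def comp.diff_left comp.diff_right comp.scaleR_left comp.scaleR_right)
    have "C o\<^sub>L Y = Y o\<^sub>L C"
    proof (rule LIMSEQ_unique)
      show "(\<lambda>n. C o\<^sub>L sqrt_iter T n) \<longlonglongrightarrow> (C o\<^sub>L Y)" by (intro comp.tendsto Y tendsto_const)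
      show "(\<lambda>n. C o\<^sub>L sqrt_iter T n) \<longlonglongrightarrow> (Y o\<^sub>L C)"
        unfolding sqrt_iter_commute[OF CT] by (intro comp.tendsto Y tendsto_const)
    qed
    then show "C o\<^sub>L R = R o\<^sub>L C"
      by (simp add: R_def comp.diff_left comp.diff_right comp.scaleR_left comp.scaleR_right)
  qed
qed

text \<open>Commutation gives \<open>(R + R') (R - R') = 0\<close>. At \<open>y = (R - R') x\<close>
  two nonnegative forms sum to zero, so both vanish; then \<open>R y = 0\<close>, and injectivity
  finishes.\<close>

lemma positive_sqrt_unique:
  fixes R R' :: "'a::chilbert_space \<Rightarrow>\<^sub>L 'a"
  assumes sym: "\<And>x y. cinner (R x) y = cinner x (R y)" and pos: "\<And>x. 0 \<le> Re (cinner (R x) x)"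
    and sym': "\<And>x y. cinner (R' x) y = cinner x (R' y)" and pos': "\<And>x. 0 \<le> Re (cinner (R' x) x)"
    and eq: "R o\<^sub>L R = R' o\<^sub>L R'" and comm: "R' o\<^sub>L R = R o\<^sub>L R'"
    and inj: "\<And>x. R x = 0 \<Longrightarrow> x = 0"
  shows "R = R'"
proof (rule blinfun_eqI)
  fix x
  have eqx: "R (R z) = R' (R' z)" and commx: "R' (R z) = R (R' z)" for z
    using eq comm by (metis blinfun_apply_blinfun_compose)+
  define y where "y = R x - R' x"
  have "R y + R' y = 0"
    by (simp add: y_def blinfun.diff_right eqx commx)
  then have "Re (cinner (R y) y) + Re (cinner (R' y) y) = 0"
    by (metis cinner.add_left cinner.zero_left plus_complex.simps(1) zero_complex.simps(1))
  then have "Re (cinner (R y) y) = 0" using pos[of y] pos'[of y] by linarith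
  then have "R y = 0" using positive_op_norm_le[OF sym pos, of y] by simp
  then show "R x = R' x" using inj y_def by force
qed

subsection \<open>The square root of a strictly positive operator\<close>

text \<open>The lower bound on \<open>T\<close> makes preimages unique, hence the inverse linear,
  and also makes it continuous.\<close>

lemma bounded_inverse_op:
  assumes sa: "self_adjoint_op D T" and inv: "has_bounded_inverse D T"
  obtains K :: "'a::chilbert_space \<Rightarrow>\<^sub>L 'a" where
    "\<And>g. K g \<in> D" "\<And>g. T (K g) = g" "\<And>f. f \<in> D \<Longrightarrow> K (T f) = f"
    "\<And>x y. cinner (K x) y = cinner x (K y)"
proof -
  obtain C where C: "\<And>f. f \<in> D \<Longrightarrow> norm f \<le> C * norm (T f)"
    using inv unfolding has_bounded_inverse_def by blast
  obtain k where k: "\<And>g. k g \<in> D" "\<And>g. T (k g) = g"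
    using inv unfolding has_bounded_inverse_def by metis
  have inj: "f = g" if "f \<in> D" "g \<in> D" "T f = T g" for f g
    using C[of "f - g"] self_adjoint_op_diff[OF sa that(1,2)] that(3) by simp
  have "bounded_linear k"
  proof (rule bounded_linear_intro)
    show "k (x + y) = k x + k y" for x y
      by (rule inj) (use k self_adjoint_op_add[OF sa] in auto)
    show "k (r *\<^sub>R x) = r *\<^sub>R k x" for r x
      by (rule inj) (use k self_adjoint_op_scaleR[OF sa] in auto)
    show "norm (k x) \<le> norm x * C" for x
      using C[OF k(1)[of x]] k(2)[of x] by (simp add: mult.commute)
  qed
  then have app: "blinfun_apply (Blinfun k) = k" by (rule bounded_linear_Blinfun_apply)
  show ?thesis
  proof (rule that[of "Blinfun k"], unfold app)
    show "cinner (k x) y = cinner x (k y)" for x y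
      using self_adjoint_op_sym[OF sa k(1) k(1), of x y] k(2) by simp
  qed (use k inj in auto)
qed

text \<open>The predicate under the definite description in \<open>op_sqrt_pair\<close>, named so
  that existence and uniqueness can be treated separately.\<close>

definition is_op_sqrt :: "'a::chilbert_space set \<Rightarrow> ('a \<Rightarrow> 'a) \<Rightarrow> 'a set \<times> ('a \<Rightarrow> 'a) \<Rightarrow> bool" where
  "is_op_sqrt D T p = (case p of (DS, S) \<Rightarrow>
      self_adjoint_op DS S \<and> positive_op DS S \<and> (\<forall>f. f \<notin> DS \<longrightarrow> S f = 0) \<and>
      D = {f \<in> DS. S f \<in> DS} \<and> (\<forall>f\<in>D. S (S f) = T f))"

text \<open>Passing to inverses turns the uniqueness of the unbounded square root into the
uniqueness of the bounded positive square root of \<open>K\<close>.\<close>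
lemma is_op_sqrt_inverse:
  fixes K :: "'a::chilbert_space \<Rightarrow>\<^sub>L 'a"
  assumes sqrt: "is_op_sqrt D T (DS, S)"
    and K: "\<And>g. K g \<in> D" "\<And>g. T (K g) = g" "\<And>f. f \<in> D \<Longrightarrow> K (T f) = f"
    and K_sym: "\<And>x y. cinner (K x) y = cinner x (K y)"
  obtains R :: "'a \<Rightarrow>\<^sub>L 'a" where
    "R o\<^sub>L R = K" "\<And>x y. cinner (R x) y = cinner x (R y)" "\<And>x. 0 \<le> Re (cinner (R x) x)"
    "DS = range R" "\<And>x. S (R x) = x"
proof -
  have sa: "self_adjoint_op DS S" and pos: "positive_op DS S"
    and D: "D = {f \<in> DS. S f \<in> DS}" and SS: "\<And>f. f \<in> D \<Longrightarrow> S (S f) = T f"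
    using sqrt by (auto simp: is_op_sqrt_def)
  \<comment> \<open>This is the inverse of \<open>S\<close>, because
    \<open>S (S (K x)) = T (K x) = x\<close>.\<close>
  define r where "r x = S (K x)" for x
  have r_DS: "r x \<in> DS" and S_r: "S (r x) = x" for x
    using K(1)[of x] D SS[OF K(1)] K(2) by (auto simp: r_def)
  have zero: "f = 0" if "f \<in> DS" "S f = 0" for f
  proof -
    have "f \<in> D" using that self_adjoint_op_zero[OF sa] D by auto
    moreover from this have "T f = 0" using SS that self_adjoint_op_zero[OF sa] by force
    ultimately show ?thesis using K(3) by (force simp: blinfun.zero_right)
  qed
  have inj: "f = g" if "f \<in> DS" "g \<in> DS" "S f = S g" for f g
    using zero[of "f - g"] self_adjoint_op_diff[OF sa that(1,2)] that(3) by simp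
  have r_S: "r (S f) = f" if "f \<in> DS" for f
    by (rule inj) (use that r_DS S_r in auto)
  have r_sym: "cinner (r x) y = cinner x (r y)" for x y
    using self_adjoint_op_sym[OF sa r_DS r_DS, of x y] S_r by simp
  have K_DS: "K x \<in> DS" for x using K(1) D by auto
  have rr: "r (r x) = K x" for x
    unfolding r_def[of x] by (rule r_S[OF K_DS])
  have "bounded_linear r"
  proof (rule bounded_linear_intro)
    show "r (x + y) = r x + r y" for x y
      by (simp add: r_def blinfun.add_right self_adjoint_op_add[OF sa K_DS K_DS])
    show "r (c *\<^sub>R x) = c *\<^sub>R r x" for c x
      by (simp add: r_def blinfun.scaleR_right self_adjoint_op_scaleR[OF sa K_DS])
    show "norm (r x) \<le> norm x * sqrt (norm K)" for x
    proof -
      have "(norm (r x))\<^sup>2 = Re (cinner x (K x))"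
        by (simp add: Re_cinner_self[symmetric] r_sym rr)
      also have "\<dots> \<le> norm x * norm (K x)" by (rule Re_cinner_le)
      also have "\<dots> \<le> norm x * (norm K * norm x)"
        by (intro mult_left_mono norm_blinfun) auto
      also have "\<dots> = (norm x * sqrt (norm K))\<^sup>2"
        by (simp add: power_mult_distrib power2_eq_square[of "norm x"])
      finally show ?thesis by (rule power2_le_imp_le) simp
    qed
  qed
  then have app: "blinfun_apply (Blinfun r) = r" by (rule bounded_linear_Blinfun_apply)
  show ?thesis
  proof (rule that[of "Blinfun r"])
    show "Blinfun r o\<^sub>L Blinfun r = K" by (rule blinfun_eqI) (simp add: app rr)
    show "0 \<le> Re (cinner (Blinfun r x) x)" for x
      using pos r_DS[of x] S_r[of x] unfolding positive_op_def app by (metis Re_cinner_commute)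
    show "DS = range (Blinfun r)"
      unfolding app using r_DS r_S by (metis image_subsetI rangeI subsetI subset_antisym)
  qed (simp_all add: app r_sym S_r)
qed

text \<open>Resolves the definite description: \<open>R\<close> is the positive root of the bounded
  inverse \<open>K\<close> of \<open>B\<close>, and its inverse, defined on \<open>range R\<close>,
  is the only square root of \<open>B\<close>.\<close>

lemma op_sqrt_characterization:
  assumes sa: "self_adjoint_op DB B" and pos: "strictly_positive_op DB B"
    and inv: "has_bounded_inverse DB B"
  obtains R :: "'a::chilbert_space \<Rightarrow>\<^sub>L 'a" where
    "\<And>x y. cinner (R x) y = cinner x (R y)"
    "op_sqrt_dom DB B = range R" "\<And>x. op_sqrt DB B (R x) = x"
    "DB = range (\<lambda>x. R (R x))" "\<And>x. B (R (R x)) = x"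
proof -
  obtain K :: "'a \<Rightarrow>\<^sub>L 'a" where K: "\<And>g. K g \<in> DB" "\<And>g. B (K g) = g" "\<And>f. f \<in> DB \<Longrightarrow> K (B f) = f"
    and K_sym: "\<And>x y. cinner (K x) y = cinner x (K y)"
    using bounded_inverse_op[OF sa inv] by blast
  have K_pos: "0 \<le> Re (cinner (K x) x)" for x
  proof (cases "K x = 0")
    case False
    then show ?thesis
      using pos K(1,2)[of x] unfolding strictly_positive_op_def
      by (metis Re_cinner_commute less_imp_le)
  qed (simp add: cinner.zero_left)
  obtain R :: "'a \<Rightarrow>\<^sub>L 'a" where RR: "R o\<^sub>L R = K"
    and R_sym: "\<And>x y. cinner (R x) y = cinner x (R y)" and R_pos: "\<And>x. 0 \<le> Re (cinner (R x) x)"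
    and R_comm: "\<And>C. C o\<^sub>L K = K o\<^sub>L C \<Longrightarrow> C o\<^sub>L R = R o\<^sub>L C"
    using positive_sqrt_exists[OF K_sym K_pos] by metis
  have RRx: "R (R x) = K x" for x using RR by (metis blinfun_apply_blinfun_compose)
  have R_zero: "x = 0" if "R x = 0" for x
    using that RRx[of x] K(2)[of x] self_adjoint_op_zero[OF sa] by (simp add: blinfun.zero_right)
  have R_inj: "inj R"
    by (rule injI) (metis R_zero blinfun.diff_right right_minus_eq)
  have DB: "DB = range K" using K(1,3) by (metis image_subsetI rangeI subsetI subset_antisym)
  \<comment> \<open>The value 0 off \<open>range R\<close> is the normalisation that
    \<open>op_sqrt_pair\<close> demands.\<close>
  define S where "S f = (if f \<in> range R then inv R f else 0)" for f
  have S_R: "S (R x) = x" for x by (simp add: S_def R_inj)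
  have "self_adjoint_op (range R) S"
    unfolding self_adjoint_op_def self_adjoint_in_def norm_eq_sqrt_cinner
  proof (intro conjI ballI allI impI)
    fix g :: 'a and e :: real assume "e > 0"
    then obtain f where "f \<in> DB" "norm (g - f) < e" using self_adjoint_op_dense[OF sa] by blast
    then show "\<exists>f\<in>range R. norm (g - f) < e" using RRx by (metis DB rangeE rangeI)
  next
    fix g assume "\<exists>h\<in>UNIV. \<forall>f\<in>range R. cinner (S f) g = cinner f h"
    then obtain h where "\<And>x. cinner x g = cinner x (R h)"
      by (auto simp: S_R R_sym)
    then show "g \<in> range R" using cinner_eqI by blast
  qed (auto simp: S_R R_sym)
  have "positive_op (range R) S"
    unfolding positive_op_def using R_pos by (auto simp: S_R Re_cinner_commute)
  have S: "is_op_sqrt DB B (range R, S)"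
  proof -
    have "DB = {f \<in> range R. S f \<in> range R}"
      unfolding DB by (auto simp: S_R RRx[symmetric])
    moreover have "S (S f) = B f" if "f \<in> DB" for f
      using that unfolding DB by (auto simp: K(2)) (simp add: S_R flip: RRx)
    ultimately show ?thesis
      using \<open>self_adjoint_op (range R) S\<close> \<open>positive_op (range R) S\<close>
      unfolding is_op_sqrt_def prod.case by (metis S_def)
  qed
  have "op_sqrt_pair DB B = (THE p. is_op_sqrt DB B p)"
    by (simp only: op_sqrt_pair_def is_op_sqrt_def)
  also have "\<dots> = (range R, S)"
  proof (rule the_equality)
    fix p assume p: "is_op_sqrt DB B p"
    obtain DS' S' where p_eq: "p = (DS', S')" by (cases p)
    obtain R' :: "'a \<Rightarrow>\<^sub>L 'a" where R': "R' o\<^sub>L R' = K" "\<And>x y. cinner (R' x) y = cinner x (R' y)"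
      "\<And>x. 0 \<le> Re (cinner (R' x) x)" "DS' = range R'" "\<And>x. S' (R' x) = x"
      using is_op_sqrt_inverse[OF p[unfolded p_eq] K K_sym] by metis
    \<comment> \<open>A competing root commutes with its own square \<open>K\<close>, hence with
      \<open>R\<close>, as uniqueness requires.\<close>
    have "R' o\<^sub>L K = K o\<^sub>L R'" unfolding R'(1)[symmetric] by (rule blinfun_eqI) simp
    then have "R = R'"
      by (intro positive_sqrt_unique[OF R_sym R_pos R'(2,3)] R_comm) (simp_all add: RR R'(1) R_zero)
    moreover have "S' = S"
    proof
      fix f show "S' f = S f"
        using p R'(4,5) S_R \<open>R = R'\<close> unfolding p_eq is_op_sqrt_def S_def by auto
    qed
    ultimately show "p = (range R, S)" using p_eq R'(4) by simp
  qed (rule S)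
  finally have "op_sqrt_dom DB B = range R" "op_sqrt DB B = S"
    by (simp_all add: op_sqrt_dom_def op_sqrt_def)
  then show ?thesis
    using that[of R] R_sym S_R DB by (simp add: RRx K(2))
qed

subsection \<open>The closure as an operator on the energy space\<close>

text \<open>Prepares the symmetric resolvent at a real point outside the spectrum: a real multiple
  of the identity moves across the inner product unchanged.\<close>

lemma self_adjoint_op_shift:
  assumes sa: "self_adjoint_op D T"
  shows "self_adjoint_op D (\<lambda>f. T f - r *\<^sub>R f)"
  unfolding self_adjoint_op_def self_adjoint_in_def norm_eq_sqrt_cinner
proof (intro conjI ballI allI impI)
  fix g assume "\<exists>h\<in>UNIV. \<forall>f\<in>D. cinner (T f - r *\<^sub>R f) g = cinner f h"
  then obtain h where h: "\<And>f. f \<in> D \<Longrightarrow> cinner (T f - r *\<^sub>R f) g = cinner f h" by blast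
  have "cinner (T f) g = cinner f (h + r *\<^sub>R g)" if "f \<in> D" for f
    using h[OF that]
    by (simp add: cinner.diff_left cinner.add_right cinner.scaleR_left cinner.scaleR_right
        algebra_simps)
  then show "g \<in> D" using self_adjoint_op_adjoint[OF sa] by blast
qed (auto simp: self_adjoint_op_dense[OF sa] self_adjoint_op_sym[OF sa] cinner.diff_left
    cinner.diff_right cinner.scaleR_left cinner.scaleR_right)

text \<open>The argument of Krein and Lax: \<open>\<parallel>R T x\<parallel>\<^sup>2 = \<langle>R T\<^sup>2 x, R x\<rangle>\<close>, so the ratios
\<open>\<parallel>R T\<^bsup>2^n\<^esup> x\<parallel> / \<parallel>R x\<parallel>\<close> at least square at each step, while they grow no faster than \<open>c\<^bsup>2^n\<^esup>\<close>.\<close>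
lemma symmetrizable_bound:
  fixes R :: "'a::chilbert_space \<Rightarrow>\<^sub>L 'a"
  assumes sym: "\<And>x y. cinner (R (T x)) (R y) = cinner (R x) (R (T y))"
    and bound: "\<And>x. norm (T x) \<le> c * norm x" and c: "c > 0"
  shows "norm (R (T x)) \<le> c * norm (R x)"
proof -
  have step: "(norm (R ((T ^^ n) x)))\<^sup>2 \<le> norm (R ((T ^^ (2 * n)) x)) * norm (R x)" for n
  proof -
    have "cinner (R ((T ^^ n) y)) (R z) = cinner (R y) (R ((T ^^ n) z))" for y z
      by (induction n arbitrary: y z) (simp_all add: sym funpow_swap1)
    then have "(norm (R ((T ^^ n) x)))\<^sup>2 = Re (cinner (R ((T ^^ n) ((T ^^ n) x))) (R x))"
      by (simp add: Re_cinner_self[symmetric])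
    also have "\<dots> \<le> norm (R ((T ^^ n) ((T ^^ n) x))) * norm (R x)" by (rule Re_cinner_le)
    also have "(T ^^ n) ((T ^^ n) x) = (T ^^ (2 * n)) x" by (simp add: funpow_add mult_2)
    finally show ?thesis .
  qed
  show ?thesis
  proof (cases "R x = 0")
    case True
    \<comment> \<open>\<open>T\<close> preserves the kernel of \<open>R\<close>, by the squared
      estimate for \<open>n = 1\<close>.\<close>
    then show ?thesis using step[of 1] by simp
  next
    case False
    define a where "a n = norm (R ((T ^^ n) x)) / norm (R x)" for n
    have a_sq: "(a n)\<^sup>2 \<le> a (2 * n)" for n
      using step[of n] False by (simp add: a_def field_simps power2_eq_square)
    have a_nonneg: "0 \<le> a n" for n by (simp add: a_def)
    have grow: "a 1 ^ (2 ^ n) \<le> a (2 ^ n)" for n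
    proof (induction n)
      case (Suc n)
      have "a 1 ^ (2 ^ Suc n) = (a 1 ^ (2 ^ n))\<^sup>2" by (simp add: power_mult[symmetric] mult.commute)
      also have "\<dots> \<le> (a (2 ^ n))\<^sup>2" by (intro power_mono Suc.IH zero_le_power a_nonneg)
      also have "\<dots> \<le> a (2 ^ Suc n)" using a_sq[of "2 ^ n"] by simp
      finally show ?case .
    qed simp
    have Tn: "norm ((T ^^ n) x) \<le> c ^ n * norm x" for n
    proof (induction n)
      case (Suc n)
      have "norm (T ((T ^^ n) x)) \<le> c * norm ((T ^^ n) x)" by (rule bound)
      also have "\<dots> \<le> c * (c ^ n * norm x)" using Suc.IH c by simp
      finally show ?case by (simp add: mult.assoc)
    qed simp
    define M where "M = norm R * norm x / norm (R x)"
    have upper: "a n \<le> M * c ^ n" for n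
    proof -
      have "norm (R ((T ^^ n) x)) \<le> norm R * norm ((T ^^ n) x)" by (rule norm_blinfun)
      also have "\<dots> \<le> norm R * (c ^ n * norm x)" by (intro mult_left_mono Tn) auto
      finally show ?thesis using False by (simp add: a_def M_def field_simps)
    qed
    \<comment> \<open>Otherwise \<open>(a 1 / c) ^ (2 ^ n)\<close> is unbounded in \<open>n\<close>,
      while \<open>grow\<close> and \<open>upper\<close> keep it below the fixed
      \<open>M\<close>.\<close>
    have "a 1 \<le> c"
    proof (rule ccontr)
      assume "\<not> a 1 \<le> c"
      then have q: "1 < a 1 / c" using c by simp
      then obtain n where "M < (a 1 / c) ^ n" using real_arch_pow by blast
      also have "\<dots> \<le> (a 1 / c) ^ (2 ^ n)" using q by (intro power_increasing) auto
      also have "\<dots> \<le> M"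
        using order_trans[OF grow[of n] upper] c by (simp add: power_divide divide_le_eq)
      finally show False by simp
    qed
    then show ?thesis using False by (simp add: a_def divide_le_eq)
  qed
qed

text \<open>Here \<open>R\<close> stands for \<open>B\<^bsup>-1/2\<^esup>\<close> and \<open>S\<close> for \<open>B\<^bsup>1/2\<^esup>\<close>. The isometry \<open>S\<close> from the energy
space onto the Hilbert space carries \<open>B\<^bsup>-1\<^esup> A\<close> to \<open>R A R\<close>, and \<open>cgraph\<close> is the closure of the
graph of the latter.\<close>
locale energy_space =
  fixes R :: "'a::chilbert_space \<Rightarrow>\<^sub>L 'a" and S :: "'a \<Rightarrow> 'a" and DA :: "'a set" and A :: "'a \<Rightarrow> 'a"
  assumes R_sym: "cinner (R x) y = cinner x (R y)"
    and S_R [simp]: "S (R x) = x"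
    and A_sa: "self_adjoint_op DA A"
    and R_dense: "e > 0 \<Longrightarrow> \<exists>x. norm (g - R x) < e"
    and S_dense: "e > 0 \<Longrightarrow> \<exists>f\<in>DA \<inter> range R. norm (g - S f) < e"
begin

lemma R_S: "f \<in> range R \<Longrightarrow> R (S f) = f"
  by auto

lemma range_diff: "f \<in> range R \<Longrightarrow> g \<in> range R \<Longrightarrow> f - g \<in> range R"
  by (auto simp flip: blinfun.diff_right)

lemma S_diff: "f \<in> range R \<Longrightarrow> g \<in> range R \<Longrightarrow> S (f - g) = S f - S g"
  by (auto simp flip: blinfun.diff_right)

lemma RA_sym:
  assumes "f \<in> DA \<inter> range R" "g \<in> DA \<inter> range R"
  shows "cinner (R (A f)) (S g) = cinner (S f) (R (A g))"
proof -
  have "cinner (R (A f)) (S g) = cinner f (A g)"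
    using assms by (simp add: R_sym R_S self_adjoint_op_sym[OF A_sa])
  also have "\<dots> = cinner (R (S f)) (A g)" using assms by (simp add: R_S)
  finally show ?thesis by (simp add: R_sym)
qed

section \<open>The closed graph of \<open>R A R\<close>\<close>

definition cgraph :: "'a \<Rightarrow> 'a \<Rightarrow> bool" where
  "cgraph g h \<longleftrightarrow> (\<exists>u. (\<forall>n::nat. u n \<in> DA \<inter> range R) \<and> (\<lambda>n. S (u n)) \<longlonglongrightarrow> g \<and> (\<lambda>n. R (A (u n))) \<longlonglongrightarrow> h)"

lemma cgraph_base: "f \<in> DA \<inter> range R \<Longrightarrow> cgraph (S f) (R (A f))"
  unfolding cgraph_def by (intro exI[of _ "\<lambda>_. f"]) simp

lemma cgraph_sym:
  assumes "cgraph g h" "cgraph g' h'"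
  shows "cinner h g' = cinner g h'"
proof -
  obtain u where u: "\<And>n. u n \<in> DA \<inter> range R" "(\<lambda>n. S (u n)) \<longlonglongrightarrow> g" "(\<lambda>n. R (A (u n))) \<longlonglongrightarrow> h"
    using assms(1) unfolding cgraph_def by blast
  obtain v where v: "\<And>n. v n \<in> DA \<inter> range R" "(\<lambda>n. S (v n)) \<longlonglongrightarrow> g'" "(\<lambda>n. R (A (v n))) \<longlonglongrightarrow> h'"
    using assms(2) unfolding cgraph_def by blast
  have "(\<lambda>n. cinner (R (A (u n))) (S (v n))) \<longlonglongrightarrow> cinner g h'"
    unfolding RA_sym[OF u(1) v(1)] by (intro cinner.tendsto u v)
  moreover have "(\<lambda>n. cinner (R (A (u n))) (S (v n))) \<longlonglongrightarrow> cinner h g'"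
    by (intro cinner.tendsto u v)
  ultimately show ?thesis using LIMSEQ_unique by blast
qed

lemma S_image_orthogonal:
  assumes "\<And>f. f \<in> DA \<inter> range R \<Longrightarrow> cinner (S f) d = cinner (S f) d'"
  shows "d = d'"
proof -
  have "d - d' = 0"
    by (rule orthogonal_to_dense[of "S ` (DA \<inter> range R)"])
      (use S_dense assms in \<open>auto simp: cinner.diff_right\<close>)
  then show ?thesis by simp
qed

text \<open>A densely defined symmetric operator is closable: \<open>h\<close> and \<open>h'\<close>
  have equal inner products with the dense set of all \<open>S f\<close>. This resolves the definite
  description in \<open>op_closure\<close>.\<close>

lemma cgraph_unique:
  assumes "cgraph g h" "cgraph g h'"
  shows "h = h'"
  using cgraph_sym[OF cgraph_base assms(1)] cgraph_sym[OF cgraph_base assms(2)]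
  by (intro S_image_orthogonal) auto

abbreviation "LD \<equiv> op_closure_dom (range R) (\<lambda>f. norm (S f)) (DA \<inter> range R) (\<lambda>f. R (R (A f)))"
abbreviation "L \<equiv> op_closure (range R) (\<lambda>f. norm (S f)) (DA \<inter> range R) (\<lambda>f. R (R (A f)))"

text \<open>The isometry \<open>S\<close> turns energy norms into ambient ones and cancels one
  factor \<open>R\<close>.\<close>

lemma closure_graph_iff:
  "closure_graph (range R) (\<lambda>f. norm (S f)) (DA \<inter> range R) (\<lambda>f. R (R (A f))) f g \<longleftrightarrow>
    f \<in> range R \<and> g \<in> range R \<and> cgraph (S f) (S g)"
proof -
  have "((\<lambda>n. norm (S (u n - f))) \<longlonglongrightarrow> 0 \<and> (\<lambda>n. norm (S (R (R (A (u n))) - g))) \<longlonglongrightarrow> 0) \<longleftrightarrow>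
      ((\<lambda>n. S (u n)) \<longlonglongrightarrow> S f \<and> (\<lambda>n. R (A (u n))) \<longlonglongrightarrow> S g)"
    if "f \<in> range R" "g \<in> range R" "\<forall>n. u n \<in> DA \<inter> range R" for u :: "nat \<Rightarrow> 'a"
    using that by (simp add: S_diff tendsto_norm_zero_iff LIM_zero_iff)
  then show ?thesis
    unfolding closure_graph_def cgraph_def by metis
qed

lemma mem_LD_iff: "f \<in> LD \<longleftrightarrow> f \<in> range R \<and> (\<exists>h. cgraph (S f) h)"
  unfolding op_closure_dom_def closure_graph_iff mem_Collect_eq by (metis S_R rangeI)

lemma L_eq:
  assumes "f \<in> range R" "cgraph (S f) h"
  shows "L f = R h"
  unfolding op_closure_def closure_graph_iff
proof (rule the_equality)
  show "f \<in> range R \<and> R h \<in> range R \<and> cgraph (S f) (S (R h))" using assms by simp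
  show "g = R h" if "f \<in> range R \<and> g \<in> range R \<and> cgraph (S f) (S g)" for g
    using cgraph_unique[OF assms(2), of "S g"] that R_S by metis
qed

lemma LD_L:
  assumes "f \<in> LD"
  shows "f \<in> range R" "cgraph (S f) (S (L f))" "L f \<in> range R"
proof -
  show f: "f \<in> range R" using assms mem_LD_iff by blast
  obtain h where "cgraph (S f) h" using assms mem_LD_iff by blast
  with L_eq[OF f this] show "cgraph (S f) (S (L f))" "L f \<in> range R" by auto
qed

lemma base_in_LD: "DA \<inter> range R \<subseteq> LD"
  using cgraph_base mem_LD_iff by blast

text \<open>\<open>full\<close> says that the graph of the adjoint of \<open>R A R\<close> lies in
  \<open>cgraph\<close>. Density and symmetry survive closure, so this inclusion is all that each of
  the three conditions has to supply.\<close>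

lemma self_adjoint_closure:
  assumes full: "\<And>g h. (\<And>f. f \<in> DA \<inter> range R \<Longrightarrow> cinner (R (A f)) g = cinner (S f) h) \<Longrightarrow> cgraph g h"
  shows "self_adjoint_in (range R) (\<lambda>f g. cinner (S f) (S g)) LD L"
  unfolding self_adjoint_in_def norm_eq_sqrt_cinner
proof (intro conjI ballI allI impI)
  show "LD \<subseteq> range R" "L ` LD \<subseteq> range R" using LD_L by auto
next
  fix g and e :: real assume "g \<in> range R" "e > 0"
  then obtain f where "f \<in> DA \<inter> range R" "norm (S g - S f) < e" using S_dense by blast
  then show "\<exists>f\<in>LD. norm (S (g - f)) < e"
    using base_in_LD S_diff[OF \<open>g \<in> range R\<close>] by (intro bexI[of _ f]) auto
next
  fix f g assume "f \<in> LD" "g \<in> LD"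
  then show "cinner (S (L f)) (S g) = cinner (S f) (S (L g))"
    using cgraph_sym LD_L by blast
next
  fix g assume g: "g \<in> range R" and "\<exists>h\<in>range R. \<forall>f\<in>LD. cinner (S (L f)) (S g) = cinner (S f) (S h)"
  then obtain h where h: "\<And>f. f \<in> LD \<Longrightarrow> cinner (S (L f)) (S g) = cinner (S f) (S h)" by blast
  have "cinner (R (A f)) (S g) = cinner (S f) (S h)" if "f \<in> DA \<inter> range R" for f
  proof -
    have "L f = R (R (A f))" using L_eq cgraph_base that by blast
    then show ?thesis using h[of f] base_in_LD that by auto
  qed
  then show "g \<in> LD" using full g mem_LD_iff by blast
qed

section \<open>Norm bounds and criteria for adjoint pairs to lie in the closed graph\<close>

lemma cgraph_norm_bound:
  assumes bound: "\<And>f. f \<in> DA \<inter> range R \<Longrightarrow> norm (R (A f)) \<le> C * norm (S f)" and "cgraph g h"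
  shows "norm h \<le> C * norm g"
proof -
  obtain u where u: "\<And>n. u n \<in> DA \<inter> range R" "(\<lambda>n. S (u n)) \<longlonglongrightarrow> g" "(\<lambda>n. R (A (u n))) \<longlonglongrightarrow> h"
    using assms(2) unfolding cgraph_def by blast
  show ?thesis
    by (rule LIMSEQ_le[OF tendsto_norm[OF u(3)] tendsto_mult_left[OF tendsto_norm[OF u(2)]]])
      (use bound[OF u(1)] in blast)
qed

text \<open>Approximating \<open>g\<close> by \<open>S (u n)\<close> with \<open>u n\<close> in
  \<open>E\<close>, boundedness makes the images converge to some \<open>k\<close>, so
  \<open>cgraph g k\<close>; symmetry identifies \<open>k\<close> with the adjoint value
  \<open>h\<close>. The set \<open>E\<close> is the whole domain under (C1) and the domain of
  \<open>B\<close> under (C2).\<close>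

lemma cgraph_of_bounded_core:
  assumes E: "E \<subseteq> DA \<inter> range R" and E_diff: "\<And>f g. f \<in> E \<Longrightarrow> g \<in> E \<Longrightarrow> f - g \<in> E"
    and E_dense: "\<And>g e. e > 0 \<Longrightarrow> \<exists>f\<in>E. norm (g - S f) < e"
    and bound: "\<And>f. f \<in> E \<Longrightarrow> norm (R (A f)) \<le> C * norm (S f)"
    and adj: "\<And>f. f \<in> DA \<inter> range R \<Longrightarrow> cinner (R (A f)) g = cinner (S f) h"
  shows "cgraph g h"
proof -
  obtain u where u: "\<And>n. u n \<in> E" "(\<lambda>n. S (u n)) \<longlonglongrightarrow> g"
    using dense_sequence[of E g S] E_dense by metis
  have uR: "u n \<in> DA \<inter> range R" for n using u(1) E by blast
  have "Cauchy (\<lambda>n. R (A (u n)))"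
  proof (rule CauchyI)
    fix e :: real assume "e > 0"
    \<comment> \<open>\<open>C\<close> may be zero or negative, hence the denominator.\<close>
    then have "e / (\<bar>C\<bar> + 1) > 0" by simp
    then obtain M where M: "\<And>m n. m \<ge> M \<Longrightarrow> n \<ge> M \<Longrightarrow> norm (S (u m) - S (u n)) < e / (\<bar>C\<bar> + 1)"
      using CauchyD[OF LIMSEQ_imp_Cauchy[OF u(2)]] by metis
    have "norm (R (A (u m)) - R (A (u n))) < e" if "m \<ge> M" "n \<ge> M" for m n
    proof -
      have "R (A (u m)) - R (A (u n)) = R (A (u m - u n))"
        using uR self_adjoint_op_diff[OF A_sa] by (simp add: blinfun.diff_right)
      then have "norm (R (A (u m)) - R (A (u n))) \<le> C * norm (S (u m) - S (u n))"
        using bound[OF E_diff[OF u(1) u(1)], of m n] uR S_diff by simp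
      also have "\<dots> \<le> (\<bar>C\<bar> + 1) * norm (S (u m) - S (u n))"
        by (intro mult_right_mono) auto
      also have "\<dots> < e" using M[OF that] by (simp add: field_simps)
      finally show ?thesis .
    qed
    then show "\<exists>M. \<forall>m\<ge>M. \<forall>n\<ge>M. norm (R (A (u m)) - R (A (u n))) < e" by blast
  qed
  then obtain k where k: "(\<lambda>n. R (A (u n))) \<longlonglongrightarrow> k"
    using Cauchy_convergent convergent_def by blast
  then have gk: "cgraph g k" unfolding cgraph_def using uR u(2) by blast
  have "k = h"
    by (rule S_image_orthogonal) (metis adj cgraph_base cgraph_sym gk)
  then show ?thesis using gk by simp
qed

text \<open>For \<open>f = R (R x)\<close> one has \<open>S f = R x\<close>, so
  \<open>symmetrizable_bound\<close> for \<open>T x = A (R (R x))\<close> is exactly boundedness of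
  \<open>R A R\<close> on the range of \<open>R\<close>.\<close>

lemma cgraph_of_relative_bound:
  assumes dom: "\<And>x. R (R x) \<in> DA"
    and bound: "\<And>x. norm (A (R (R x))) \<le> c * norm x" and c: "c > 0"
    and adj: "\<And>f. f \<in> DA \<inter> range R \<Longrightarrow> cinner (R (A f)) g = cinner (S f) h"
  shows "cgraph g h"
proof (rule cgraph_of_bounded_core[OF _ _ _ _ adj, of "range (\<lambda>x. R (R x))" c])
  have sym: "cinner (R (A (R (R x)))) (R y) = cinner (R x) (R (A (R (R y))))" for x y
    using RA_sym[of "R (R x)" "R (R y)"] dom by simp
  show "range (\<lambda>x. R (R x)) \<subseteq> DA \<inter> range R" using dom by auto
  show "f - g \<in> range (\<lambda>x. R (R x))" if "f \<in> range (\<lambda>x. R (R x))" "g \<in> range (\<lambda>x. R (R x))" for f g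
    using that by (auto simp flip: blinfun.diff_right)
  show "\<exists>f\<in>range (\<lambda>x. R (R x)). norm (g - S f) < e" if "e > 0" for g e
    using R_dense[OF that, of g] by simp
  show "norm (R (A f)) \<le> c * norm (S f)" if "f \<in> range (\<lambda>x. R (R x))" for f
    using that symmetrizable_bound[of R "\<lambda>x. A (R (R x))", OF sym bound c] by auto
qed

text \<open>For \<open>Q = (A - r)\<^bsup>-1\<^esup>\<close> the operator \<open>S Q S\<close> extends to a bounded operator, by which one solves
\<open>R (A - r) R w = k\<close> for \<open>k\<close> in the dense range of \<open>R\<close>.\<close>
lemma cgraph_of_resolvent:
  fixes Q :: "'a \<Rightarrow>\<^sub>L 'a"
  assumes Q: "\<And>x. Q x \<in> DA" "\<And>x. A (Q x) - r *\<^sub>R Q x = x"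
    and Q_sym: "\<And>x y. cinner (Q x) y = cinner x (Q y)"
    and dom: "\<And>f. f \<in> DA \<Longrightarrow> f = R (R (B f))"
    and bound: "\<And>x. norm (B (Q x)) \<le> c * norm x" and c: "c > 0"
    and adj: "\<And>f. f \<in> DA \<inter> range R \<Longrightarrow> cinner (R (A f)) g = cinner (S f) h"
  shows "cgraph g h"
proof -
  have Q_eq: "Q x = R (R (B (Q x)))" for x using dom[OF Q(1)] .
  have QR: "Q x \<in> DA \<inter> range R" for x using Q(1) Q_eq by (metis IntI rangeI)
  have SQ: "S (Q x) = R (B (Q x))" for x using Q_eq[of x] by (metis S_R)
  have AQ: "A (Q x) = x + r *\<^sub>R Q x" for x using Q(2)[of x] by (simp add: algebra_simps)
  have "cinner (R (B (Q x))) (R y) = cinner (R x) (R (B (Q y)))" for x y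
  proof -
    have "cinner (R (B (Q x))) (R y) = cinner (R (R (B (Q x)))) y" by (simp add: R_sym)
    also have "\<dots> = cinner x (R (R (B (Q y))))" by (simp add: Q_eq[symmetric] Q_sym)
    finally show ?thesis by (simp add: R_sym)
  qed
  then have SQ_bound: "norm (S (Q x)) \<le> c * norm (R x)" for x
    unfolding SQ using symmetrizable_bound[of R "\<lambda>x. B (Q x)", OF _ bound c] by simp
  \<comment> \<open>The value at \<open>g\<close> of the adjoint of
    \<open>R (A - r) R\<close>.\<close>
  define h' where "h' = h - r *\<^sub>R R (R g)"
  obtain x where x: "(\<lambda>n. R (x n)) \<longlonglongrightarrow> h'"
    using dense_sequence[of UNIV h' R] R_dense by (metis UNIV_I)
  have "Cauchy (\<lambda>n. S (Q (x n)))"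
  proof (rule CauchyI)
    fix e :: real assume "e > 0"
    then have "e / c > 0" using c by simp
    then obtain M where M: "\<And>m n. m \<ge> M \<Longrightarrow> n \<ge> M \<Longrightarrow> norm (R (x m) - R (x n)) < e / c"
      using CauchyD[OF LIMSEQ_imp_Cauchy[OF x]] by metis
    have "norm (S (Q (x m)) - S (Q (x n))) < e" if "m \<ge> M" "n \<ge> M" for m n
    proof -
      have "norm (S (Q (x m)) - S (Q (x n))) \<le> c * norm (R (x m) - R (x n))"
        using SQ_bound[of "x m - x n"] QR S_diff by (simp add: blinfun.diff_right)
      also have "\<dots> < e" using M[OF that] c by (simp add: field_simps)
      finally show ?thesis .
    qed
    then show "\<exists>M. \<forall>m\<ge>M. \<forall>n\<ge>M. norm (S (Q (x m)) - S (Q (x n))) < e" by blast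
  qed
  then obtain w where w: "(\<lambda>n. S (Q (x n))) \<longlonglongrightarrow> w"
    using Cauchy_convergent convergent_def by blast
  \<comment> \<open>The extension of \<open>S Q S\<close> is symmetric and sends \<open>h'\<close>
    to \<open>w\<close>. Testing the adjoint relation on \<open>Q y\<close> shows that
    \<open>g\<close> has the same inner products with the dense range of \<open>R\<close>.\<close>
  have "w = g"
  proof -
    have "cinner (R y) (w - g) = 0" for y
    proof -
      have RQ: "R (Q y) = R (R (S (Q y)))" using R_S QR by simp
      have "cinner (R y) g = cinner (R (A (Q y))) g - r *\<^sub>R cinner (R (Q y)) g"
        by (simp add: AQ blinfun.add_right blinfun.scaleR_right cinner.add_left cinner.scaleR_left)
      also have "\<dots> = cinner (S (Q y)) h'"
        unfolding adj[OF QR] RQ h'_def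
        by (simp add: R_sym cinner.diff_right cinner.scaleR_right)
      finally have 1: "cinner (R y) g = cinner (S (Q y)) h'" .
      have "cinner (S (Q y)) (R (x n)) = cinner (R y) (S (Q (x n)))" for n
      proof -
        have "cinner (S (Q y)) (R (x n)) = cinner (Q y) (x n)"
          using R_S QR by (simp flip: R_sym)
        also have "\<dots> = cinner y (R (S (Q (x n))))" using R_S QR Q_sym by simp
        finally show ?thesis by (simp add: R_sym)
      qed
      then have "(\<lambda>n. cinner (R y) (S (Q (x n)))) \<longlonglongrightarrow> cinner (S (Q y)) h'"
        using cinner.tendsto[OF tendsto_const x, of "S (Q y)"] by simp
      moreover have "(\<lambda>n. cinner (R y) (S (Q (x n)))) \<longlonglongrightarrow> cinner (R y) w"
        by (intro cinner.tendsto tendsto_const w)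
      ultimately have "cinner (R y) w = cinner (R y) g" using 1 LIMSEQ_unique by metis
      then show ?thesis by (simp add: cinner.diff_right)
    qed
    then have "w - g = 0"
      by (intro orthogonal_to_dense[of "range R"]) (use R_dense in auto)
    then show ?thesis by simp
  qed
  \<comment> \<open>Undoes the shift: since \<open>w = g\<close>, the limit is
    \<open>h\<close>.\<close>
  have "(\<lambda>n. R (x n) + r *\<^sub>R R (R (S (Q (x n))))) \<longlonglongrightarrow> h' + r *\<^sub>R R (R w)"
    by (intro tendsto_intros x w)
  moreover have "R (x n) + r *\<^sub>R R (R (S (Q (x n)))) = R (A (Q (x n)))" for n
    using QR by (simp add: R_S AQ blinfun.add_right blinfun.scaleR_right)
  ultimately have "(\<lambda>n. R (A (Q (x n)))) \<longlonglongrightarrow> h"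
    by (simp add: h'_def \<open>w = g\<close>)
  then show ?thesis
    unfolding cgraph_def using QR w \<open>w = g\<close> by (intro exI[of _ "\<lambda>n. Q (x n)"]) blast
qed

end

section \<open>Self-adjointness and boundedness under the three conditions\<close>

theorem theorem1:
  fixes DA DB :: "'a::chilbert_space set" and A B :: "'a \<Rightarrow> 'a"
  defines "DS \<equiv> op_sqrt_dom DB B"
      and "S \<equiv> op_sqrt DB B"
      and "Sinv \<equiv> inv_into (op_sqrt_dom DB B) (op_sqrt DB B)"
      and "Binv \<equiv> inv_into DB B"
  assumes sep: "separable_space TYPE('a)"
    and A_sa: "self_adjoint_op DA A"
    and B_sa: "self_adjoint_op DB B"
    and B_pos: "strictly_positive_op DB B"
    and B_inv: "has_bounded_inverse DB B"
    and dense: "\<forall>g\<in>DS. \<forall>e>0. \<exists>f\<in>DA \<inter> DS. norm (S (g - f)) < e"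
    and closable: "\<forall>u. (\<forall>n. u n \<in> DA \<inter> DS) \<and> (\<lambda>n. norm (S (u n))) \<longlonglongrightarrow> 0 \<and>
          (\<forall>e>0. \<exists>N. \<forall>m\<ge>N. \<forall>n\<ge>N. norm (Sinv (A (u m) - A (u n))) < e)
          \<longrightarrow> (\<lambda>n. norm (Sinv (A (u n)))) \<longlonglongrightarrow> 0"
    and conds:
      "(\<exists>a>0. \<exists>b>0. \<forall>f\<in>DA \<inter> DS. norm (Sinv (A f)) \<le> a * norm f + b * norm (S f))
       \<or> (DB \<subseteq> DA \<and> (\<exists>a>0. \<exists>b>0. \<forall>f\<in>DB. norm (A f) \<le> a * norm f + b * norm (B f)))
       \<or> (\<not> (\<forall>x::real. complex_of_real x \<in> spectrum_op DA A) \<and> DA \<subseteq> DB \<and>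
          (\<exists>a>0. \<exists>b>0. \<forall>f\<in>DA. norm (B f) \<le> a * norm f + b * norm (A f)))"
  shows "self_adjoint_in DS (\<lambda>f g. cinner (S f) (S g))
           (op_closure_dom DS (\<lambda>f. norm (S f)) (DA \<inter> DS) (\<lambda>f. Binv (A f)))
           (op_closure DS (\<lambda>f. norm (S f)) (DA \<inter> DS) (\<lambda>f. Binv (A f)))
       \<and> ((\<exists>a>0. \<exists>b>0. \<forall>f\<in>DA \<inter> DS. norm (Sinv (A f)) \<le> a * norm f + b * norm (S f))
          \<longrightarrow> (\<exists>C. \<forall>f\<in>op_closure_dom DS (\<lambda>f. norm (S f)) (DA \<inter> DS) (\<lambda>f. Binv (A f)).
                 norm (S (op_closure DS (\<lambda>f. norm (S f)) (DA \<inter> DS) (\<lambda>f. Binv (A f)) f))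
                   \<le> C * norm (S f)))"
proof -
  obtain R :: "'a \<Rightarrow>\<^sub>L 'a" where R_sym: "\<And>x y. cinner (R x) y = cinner x (R y)"
    and DS: "DS = range R" and S_R: "\<And>x. S (R x) = x"
    and DB: "DB = range (\<lambda>x. R (R x))" and B_RR: "\<And>x. B (R (R x)) = x"
    using op_sqrt_characterization[OF B_sa B_pos B_inv] unfolding DS_def S_def by metis
  have Sinv: "Sinv g = R g" for g
  proof -
    have "inj_on S DS" unfolding DS by (rule inj_onI) (auto simp: S_R)
    then show ?thesis
      unfolding Sinv_def DS_def[symmetric] S_def[symmetric]
      using inv_into_f_f[of S DS "R g"] by (simp add: DS S_R)
  qed
  have Binv: "Binv g = R (R g)" for g
  proof -
    have "inj_on B DB" unfolding DB by (rule inj_onI) (auto simp: B_RR)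
    then show ?thesis
      unfolding Binv_def using inv_into_f_f[of B DB "R (R g)"] by (simp add: DB B_RR)
  qed
  interpret energy_space R S DA A
  proof
    show "\<exists>x. norm (g - R x) < e" if "e > 0" for g e
      using self_adjoint_op_dense[OF B_sa that, of g] unfolding DB by blast
    \<comment> \<open>Density in the energy space is applied to \<open>R g\<close>, whose image
      under \<open>S\<close> is \<open>g\<close>.\<close>
    show "\<exists>f\<in>DA \<inter> range R. norm (g - S f) < e" if e: "e > 0" for g e
    proof -
      obtain f where f: "f \<in> DA \<inter> range R" "norm (S (R g - f)) < e"
        using dense[unfolded DS, rule_format, OF rangeI e] by metis
      then obtain y where "f = R y" by blast
      then have "S (R g - f) = g - S f" by (metis S_R blinfun.diff_right)
      then show ?thesis using f by metis
    qed
  qed (simp_all add: R_sym S_R A_sa)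
  \<comment> \<open>As \<open>f = R (S f)\<close>, the term \<open>a * norm f\<close> is absorbed
    into the energy norm. The bound serves both self-adjointness and boundedness.\<close>
  have C1_bound: "\<exists>C. \<forall>f\<in>DA \<inter> range R. norm (R (A f)) \<le> C * norm (S f)"
    if C1: "\<exists>a>0. \<exists>b>0. \<forall>f\<in>DA \<inter> DS. norm (Sinv (A f)) \<le> a * norm f + b * norm (S f)"
  proof -
    obtain a b where ab: "a > 0" "\<And>f. f \<in> DA \<inter> range R \<Longrightarrow> norm (R (A f)) \<le> a * norm f + b * norm (S f)"
      using C1 unfolding Sinv DS by blast
    have "norm (R (A f)) \<le> (a * norm R + b) * norm (S f)" if f: "f \<in> DA \<inter> range R" for f
    proof -
      have "norm f \<le> norm R * norm (S f)" using norm_blinfun[of R "S f"] R_S f by simp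
      then have "a * norm f \<le> a * (norm R * norm (S f))" using ab(1) by simp
      then show ?thesis using ab(2)[OF f] by (simp add: algebra_simps)
    qed
    then show ?thesis by blast
  qed
  have "cgraph g h" if adj: "\<And>f. f \<in> DA \<inter> range R \<Longrightarrow> cinner (R (A f)) g = cinner (S f) h" for g h
    using conds
  proof (elim disjE)
    assume "\<exists>a>0. \<exists>b>0. \<forall>f\<in>DA \<inter> DS. norm (Sinv (A f)) \<le> a * norm f + b * norm (S f)"
    then obtain C where C: "\<And>f. f \<in> DA \<inter> range R \<Longrightarrow> norm (R (A f)) \<le> C * norm (S f)"
      using C1_bound by blast
    show ?thesis
      by (rule cgraph_of_bounded_core[OF subset_refl _ S_dense C adj])
        (auto simp: self_adjoint_op_diff[OF A_sa] range_diff)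
  next
    assume C2: "DB \<subseteq> DA \<and> (\<exists>a>0. \<exists>b>0. \<forall>f\<in>DB. norm (A f) \<le> a * norm f + b * norm (B f))"
    then obtain a b where ab: "a > 0" "b > 0" "\<forall>f\<in>DB. norm (A f) \<le> a * norm f + b * norm (B f)"
      by blast
    have "norm (A (R (R x))) \<le> (a * norm (R o\<^sub>L R) + b) * norm x" for x
    proof -
      have "a * norm (R (R x)) \<le> a * (norm (R o\<^sub>L R) * norm x)"
        using norm_blinfun[of "R o\<^sub>L R" x] ab(1) by simp
      moreover have "norm (A (R (R x))) \<le> a * norm (R (R x)) + b * norm x"
        using bspec[OF ab(3), of "R (R x)"] DB B_RR[of x] by simp
      ultimately show ?thesis by (simp add: algebra_simps)
    qed
    then show ?thesis
      by (rule cgraph_of_relative_bound[rotated, OF _ _ adj])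
        (use ab C2 DB in \<open>auto intro: add_nonneg_pos\<close>)
  next
    assume C3: "\<not> (\<forall>x::real. complex_of_real x \<in> spectrum_op DA A) \<and> DA \<subseteq> DB \<and>
      (\<exists>a>0. \<exists>b>0. \<forall>f\<in>DA. norm (B f) \<le> a * norm f + b * norm (A f))"
    then obtain a b where ab: "a > 0" "b > 0" "\<forall>f\<in>DA. norm (B f) \<le> a * norm f + b * norm (A f)"
      by blast
    \<comment> \<open>A real \<open>r\<close> keeps \<open>A - r\<close> self-adjoint, so its
      inverse \<open>Q\<close> is symmetric.\<close>
    obtain r :: real where "complex_of_real r \<notin> spectrum_op DA A" using C3 by blast
    then have "has_bounded_inverse DA (\<lambda>f. A f - r *\<^sub>R f)"
      unfolding spectrum_op_def has_bounded_inverse_def by (simp add: scaleC_of_real)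
    then obtain Q :: "'a \<Rightarrow>\<^sub>L 'a" where Q: "\<And>x. Q x \<in> DA" "\<And>x. A (Q x) - r *\<^sub>R Q x = x"
      "\<And>x y. cinner (Q x) y = cinner x (Q y)"
      using bounded_inverse_op[OF self_adjoint_op_shift[OF A_sa]] by metis
    \<comment> \<open>The constant comes from (C3) at \<open>Q x\<close>, using
      \<open>A (Q x) = x + r Q x\<close>.\<close>
    have "norm (B (Q x)) \<le> (a * norm Q + b * (1 + \<bar>r\<bar> * norm Q)) * norm x" for x
    proof -
      have "A (Q x) = x + r *\<^sub>R Q x" using Q(2)[of x] by (simp add: algebra_simps)
      then have "norm (A (Q x)) \<le> norm x + \<bar>r\<bar> * norm (Q x)"
        using norm_triangle_ineq[of x "r *\<^sub>R Q x"] by simp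
      also have "\<dots> \<le> norm x + \<bar>r\<bar> * (norm Q * norm x)"
        by (intro add_left_mono mult_left_mono norm_blinfun) auto
      finally have "b * norm (A (Q x)) \<le> b * (norm x + \<bar>r\<bar> * (norm Q * norm x))" using ab(2) by simp
      moreover have "a * norm (Q x) \<le> a * (norm Q * norm x)" using norm_blinfun[of Q x] ab(1) by simp
      moreover have "norm (B (Q x)) \<le> a * norm (Q x) + b * norm (A (Q x))" using ab(3) Q(1) by blast
      ultimately show ?thesis by (simp add: algebra_simps)
    qed
    moreover have "f = R (R (B f))" if "f \<in> DA" for f
      using that C3 B_RR unfolding DB by fastforce
    moreover have "0 < a * norm Q + b * (1 + \<bar>r\<bar> * norm Q)"
      using ab(1,2) by (intro add_nonneg_pos mult_pos_pos mult_nonneg_nonneg add_pos_nonneg) auto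
    ultimately show ?thesis
      using cgraph_of_resolvent[OF Q _ _ _ adj] by blast
  qed
  then have "self_adjoint_in (range R) (\<lambda>f g. cinner (S f) (S g)) LD L"
    by (rule self_adjoint_closure)
  moreover have "\<exists>C. \<forall>f\<in>LD. norm (S (L f)) \<le> C * norm (S f)"
    if "\<exists>a>0. \<exists>b>0. \<forall>f\<in>DA \<inter> DS. norm (Sinv (A f)) \<le> a * norm f + b * norm (S f)"
    using C1_bound[OF that] cgraph_norm_bound LD_L(2) by metis
  ultimately show ?thesis
    unfolding DS Binv by blast
qed

end
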